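(* Let $G$ be a graph with vertices labeled $1,\dots,n$ and let $A\in\mathcal{S}(G)$. If the Gershgorin intersection graph of $A$ is (identically, with respect to the common labeling $1,\dots,n$) a subgraph of $G$, then $A$ has the SSP.
   Context: $\mathcal{S}(G)$ is the set of real symmetric $n\times n$ matrices $A=(a_{ij})$ with $a_{ij}\ne0$ iff $ij\in E(G)$ for $i\ne j$. The Gershgorin intersection graph of $A=(a_{ij})$ is the graph on vertices $1,\dots,n$ in which distinct $i,j$ are adjacent exactly when $|a_{ii}-a_{jj}|\le\sum_{\ell\ne i}|a_{i\ell}|+\sum_{\ell\ne j}|a_{j\ell}|$. Being identically a subgraph means every edge $ij$ of the Gershgorin intersection graph is an edge $ij$ of $G$. $\circ$ is the entrywise product. A real symmetric $A$ has the Strong Spectral Property (SSP) if the only real symmetric $X$ with $A\circ X=O$, $I\circ X=O$, $AX-XA=O$ is $X=O$. *)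

theory Defs
  imports "HOL-Analysis.Analysis" "Graph_Theory.Pair_Digraph"
begin

text \<open>
  A graph with vertices labelled \<open>1, \<dots>, n\<close> is a \<^locale>\<open>pair_graph\<close> (finite, loop-free, symmetric
  arc set) whose vertex set is the whole index type \<open>'n\<close>, where \<open>n = CARD('n)\<close>. An edge \<open>ij\<close> is the
  pair of opposite arcs \<open>(i, j)\<close> and \<open>(j, i)\<close>.
\<close>

definition symmetric_matrices_of :: "'n::finite pair_pre_digraph \<Rightarrow> (real^'n^'n) set" where
  "symmetric_matrices_of G =
     {A. transpose A = A \<and> (\<forall>i j. i \<noteq> j \<longrightarrow> (A $ i $ j \<noteq> 0 \<longleftrightarrow> (i, j) \<in> parcs G))}"

definition gershgorin_graph :: "real^'n^'n \<Rightarrow> 'n::finite pair_pre_digraph" where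
  "gershgorin_graph A =
     \<lparr> pverts = UNIV,
       parcs = {(i, j). i \<noteq> j \<and>
         \<bar>A $ i $ i - A $ j $ j\<bar> \<le> (\<Sum>l\<in>UNIV - {i}. \<bar>A $ i $ l\<bar>) + (\<Sum>l\<in>UNIV - {j}. \<bar>A $ j $ l\<bar>)} \<rparr>"

lemma pair_graph_gershgorin_graph: "pair_graph (gershgorin_graph A)"
  by unfold_locales
    (auto simp: gershgorin_graph_def abs_minus_commute add.commute symmetric_def
      intro!: symI dest: symD)

text \<open>
  On \<open>real^'n^'n\<close> the operation \<open>*\<close> is the entrywise product, while \<open>**\<close> is the matrix product;
  the identity matrix is \<open>mat 1\<close> (and not \<open>1\<close>, which is the all-ones matrix).
\<close>

lemma entrywise_product_nth: "((A :: real^'n^'n) * X) $ i $ j = A $ i $ j * X $ i $ j"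
  by simp

definition strong_spectral_property :: "real^'n^'n \<Rightarrow> bool" where
  "strong_spectral_property A \<longleftrightarrow>
     transpose A = A \<and>
     (\<forall>X :: real^'n^'n. transpose X = X \<and> A * X = 0 \<and> mat 1 * X = 0 \<and> A ** X - X ** A = 0
        \<longrightarrow> X = 0)"

end

theory Submission
  imports Defs
begin

text \<open>
  Compare the two sides of \<open>A ** X = X ** A\<close> at an entry \<open>X $ i $ j\<close> of maximal modulus: the diagonal
  contributions differ by \<open>(A $ i $ i - A $ j $ j) * X $ i $ j\<close>, while the off-diagonal ones are at most
  the sum of the two Gershgorin radii times \<open>\<bar>X $ i $ j\<bar>\<close>. If \<open>X $ i $ j \<noteq> 0\<close>, the discs of \<open>i\<close> and
  \<open>j\<close> therefore meet, so \<open>ij\<close> is an edge of \<open>G\<close>, which contradicts \<open>A * X = 0\<close>.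
\<close>

text \<open>The maximum ranges over the whole matrix because the later estimate needs it along both
  a column and a row of \<open>X\<close>.\<close>

lemma abs_max_entry_obtain:
  fixes X :: "real^'n::finite^'m::finite"
  obtains i j where "\<And>k l. \<bar>X $ k $ l\<bar> \<le> \<bar>X $ i $ j\<bar>"
proof -
  let ?f = "\<lambda>p. \<bar>X $ fst p $ snd p\<bar>"
  have "Max (range ?f) \<in> range ?f"
    by (intro Max_in) auto
  then obtain p where p: "Max (range ?f) = ?f p"
    by blast
  have "\<bar>X $ k $ l\<bar> \<le> ?f p" for k l
  proof -
    have "?f (k, l) \<le> Max (range ?f)"
      by (intro Max_ge finite_imageI finite rangeI)
    then show ?thesis
      using p by simp
  qed
  then show thesis
    by (rule that)
qed

lemma gershgorin_radius_sum_bound: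
  fixes a x :: "'n::finite \<Rightarrow> real"
  assumes "\<And>l. \<bar>x l\<bar> \<le> M"
  shows "\<bar>\<Sum>l\<in>S. a l * x l\<bar> \<le> (\<Sum>l\<in>S. \<bar>a l\<bar>) * M"
proof -
  have "\<bar>\<Sum>l\<in>S. a l * x l\<bar> \<le> (\<Sum>l\<in>S. \<bar>a l * x l\<bar>)"
    by (rule sum_abs)
  also have "\<dots> \<le> (\<Sum>l\<in>S. \<bar>a l\<bar> * M)"
    using assms by (intro sum_mono) (simp add: abs_mult mult_left_mono)
  finally show ?thesis
    by (simp add: sum_distrib_right)
qed

lemma commuting_gershgorin_discs_meet:
  fixes A X :: "real^'n::finite^'n"
  assumes sym: "transpose A = A"
    and comm: "A ** X = X ** A"
    and max: "\<And>k l. \<bar>X $ k $ l\<bar> \<le> \<bar>X $ i $ j\<bar>"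
    and nz: "X $ i $ j \<noteq> 0"
  shows "\<bar>A $ i $ i - A $ j $ j\<bar>
    \<le> (\<Sum>l\<in>UNIV - {i}. \<bar>A $ i $ l\<bar>) + (\<Sum>l\<in>UNIV - {j}. \<bar>A $ j $ l\<bar>)"
    (is "_ \<le> ?R + ?S")
proof -
  let ?s = "\<Sum>l\<in>UNIV - {i}. A $ i $ l * X $ l $ j"
  let ?t = "\<Sum>l\<in>UNIV - {j}. A $ j $ l * X $ i $ l"
  \<comment> \<open>The entry of \<open>X ** A\<close> involves column \<open>j\<close> of
    \<open>A\<close>; symmetry turns it into row \<open>j\<close>, whose off-diagonal absolute sum
    is the second Gershgorin radius.\<close>
  have symD: "A $ l $ j = A $ j $ l" for l
    using sym by (metis transpose_def vec_lambda_beta)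
  have "(X ** A) $ i $ j = (\<Sum>l\<in>UNIV. A $ j $ l * X $ i $ l)"
    unfolding matrix_matrix_mult_def vec_lambda_beta
    by (intro sum.cong refl) (metis symD mult.commute)
  then have XA: "(X ** A) $ i $ j = A $ j $ j * X $ i $ j + ?t"
    by (simp add: sum.remove[of UNIV j])
  have "(A ** X) $ i $ j = A $ i $ i * X $ i $ j + ?s"
    by (simp add: matrix_matrix_mult_def sum.remove[of UNIV i])
  then have "(A $ i $ i - A $ j $ j) * X $ i $ j = ?t - ?s"
    using comm XA by (simp add: algebra_simps)
  then have "\<bar>A $ i $ i - A $ j $ j\<bar> * \<bar>X $ i $ j\<bar> = \<bar>?t - ?s\<bar>"
    by (metis abs_mult)
  also have "\<dots> \<le> \<bar>?s\<bar> + \<bar>?t\<bar>"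
    by linarith
  \<comment> \<open>\<open>?s\<close> runs along column \<open>j\<close> of \<open>X\<close> and
    \<open>?t\<close> along row \<open>i\<close>; the maximal entry bounds both. The positive factor
    \<open>\<bar>X $ i $ j\<bar>\<close> is cancelled at the end.\<close>
  also have "\<dots> \<le> ?R * \<bar>X $ i $ j\<bar> + ?S * \<bar>X $ i $ j\<bar>"
    by (intro add_mono gershgorin_radius_sum_bound max)
  also have "\<dots> = (?R + ?S) * \<bar>X $ i $ j\<bar>"
    by (simp add: distrib_right)
  finally show ?thesis
    using nz by simp
qed

theorem theorem3p7:
  fixes G :: "'n::finite pair_pre_digraph" and A :: "real^'n^'n"
  assumes "pair_graph G"
    and "pverts G = UNIV"
    and "A \<in> symmetric_matrices_of G"
    and "parcs (gershgorin_graph A) \<subseteq> parcs G"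
  shows "strong_spectral_property A"
  unfolding strong_spectral_property_def
proof (intro conjI allI impI)
  show sym: "transpose A = A"
    using assms(3) by (simp add: symmetric_matrices_of_def)
  fix X :: "real^'n^'n"
  assume X: "transpose X = X \<and> A * X = 0 \<and> mat 1 * X = 0 \<and> A ** X - X ** A = 0"
  obtain i j where max: "\<And>k l. \<bar>X $ k $ l\<bar> \<le> \<bar>X $ i $ j\<bar>"
    using abs_max_entry_obtain[of X] by blast
  have "X $ i $ j = 0"
  proof (rule ccontr)
    assume nz: "X $ i $ j \<noteq> 0"
    have "A $ i $ j * X $ i $ j = 0" "mat 1 $ i $ j * X $ i $ j = 0"
      using X by (metis entrywise_product_nth zero_index)+
    \<comment> \<open>The diagonal of \<open>mat 1\<close> is 1, so a nonzero entry of
      \<open>X\<close> lies off the diagonal. There \<open>A $ i $ j = 0\<close> means that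
      \<open>ij\<close> is a non-edge of \<open>G\<close>.\<close>
    then have "A $ i $ j = 0" "i \<noteq> j"
      using nz by (auto simp: mat_def)
    moreover have "A ** X = X ** A"
      using X by simp
    then have "(i, j) \<in> parcs (gershgorin_graph A)"
      using commuting_gershgorin_discs_meet[OF sym _ max nz] \<open>i \<noteq> j\<close>
      by (simp add: gershgorin_graph_def)
    ultimately show False
      using assms(3,4) by (auto simp: symmetric_matrices_of_def)
  qed
  then show "X = 0"
    using max by (simp add: vec_eq_iff)
qed

end
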